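(* Let $M,M_o$ be integers with $0<M_o<M$, let $\mu_1,\dots,\mu_M\in(0,1)$ be the elite empirical averages (see context), and consider the problem $$\max_{\mathbf p}\ \Phi(\mathbf p)=\sum_{i=1}^M\Big(\mu_i\log p_i+(1-\mu_i)\log(1-p_i)\Big)\quad\text{s.t.}\quad \sum_{i=1}^Mp_i=M_o,\ \ \mathbf p\in(0,1)^M.$$ Let $\mathbf p^{[t]}\in(0,1)^M$ satisfy $\sum_{i=1}^Mp_i^{[t]}=M_o$, and let $\mathbf p^{\mathrm{CE}}=\mathbf p(\nu^\dagger)$ be the vector defined in the context (the exact maximizer of the problem). Then $\mathbf p^{\mathrm{CE}}$ strictly increases $\Phi$, i.e. $\Phi(\mathbf p^{\mathrm{CE}})>\Phi(\mathbf p^{[t]})$, unless $\mathbf p^{[t]}$ already solves the problem. Moreover, for any $\omega\in(0,1]$, the smoothed update $$\mathbf p^{[t+1]}=(1-\omega)\mathbf p^{[t]}+\omega\,\mathbf p^{\mathrm{CE}}$$ yields $\Phi(\mathbf p^{[t+1]})\ge\Phi(\mathbf p^{[t]})$.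
   Context: The numbers $\mu_i$ arise as follows: given a nonempty finite set $\mathcal E$ of $N_e$ indices and binary vectors $\boldsymbol\zeta_n\in\{0,1\}^M$, $n\in\mathcal E$ (the "elite" samples), $\mu_i=\frac1{N_e}\sum_{n\in\mathcal E}\zeta_{n,i}$, where $\zeta_{n,i}$ is the $i$-th component of $\boldsymbol\zeta_n$. For $\nu\in\mathbb R$, $\mathbf p(\nu)=[p_1(\nu)\cdots p_M(\nu)]^{\mathrm T}$ with $p_i(\nu)=\mu_i$ if $\nu=0$ and $p_i(\nu)=\frac{(\nu+1)-\sqrt{(\nu+1)^2-4\nu\mu_i}}{2\nu}$ if $\nu\neq0$. $\nu^\dagger$ is the unique real number with $\sum_{i=1}^Mp_i(\nu^\dagger)=M_o$; $\mathbf p(\nu^\dagger)$ is the unique maximizer of the stated problem. $\log$ is the natural logarithm. *)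

theory Defs
  imports "HOL-Analysis.Analysis"
begin

definition elite_mean :: "'e set \<Rightarrow> ('e \<Rightarrow> real ^ 'm) \<Rightarrow> real ^ 'm" where
  "elite_mean E zeta = (\<chi> i. (1 / real (card E)) * (\<Sum>n\<in>E. zeta n $ i))"

definition Phi :: "real ^ 'm \<Rightarrow> real ^ 'm \<Rightarrow> real" where
  "Phi mu p = (\<Sum>i\<in>UNIV. mu $ i * ln (p $ i) + (1 - mu $ i) * ln (1 - p $ i))"

definition feasible :: "nat \<Rightarrow> real ^ 'm \<Rightarrow> bool" where
  "feasible Mo p \<longleftrightarrow> (\<Sum>i\<in>UNIV. p $ i) = real Mo \<and> (\<forall>i. p $ i \<in> {0<..<1})"

definition p_vec :: "real ^ 'm \<Rightarrow> real \<Rightarrow> real ^ 'm" where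
  "p_vec mu nu = (\<chi> i. if nu = 0 then mu $ i
     else ((nu + 1) - sqrt ((nu + 1)\<^sup>2 - 4 * nu * mu $ i)) / (2 * nu))"

(* Such a nu exists and is unique when 0 < Mo < CARD('m) and every mu $ i lies in (0,1);
   outside that range the description need not denote. *)
definition nu_dagger :: "nat \<Rightarrow> real ^ 'm \<Rightarrow> real" where
  "nu_dagger Mo mu = (THE nu. (\<Sum>i\<in>UNIV. p_vec mu nu $ i) = real Mo)"

definition p_CE :: "nat \<Rightarrow> real ^ 'm \<Rightarrow> real ^ 'm" where
  "p_CE Mo mu = p_vec mu (nu_dagger Mo mu)"

end

(* Each summand of Phi is concave with derivative score mu_i p_i = mu_i / p_i - (1 - mu_i) / (1 - p_i),
   and p_i(nu) is the point of (0,1) at which this derivative equals nu. Hence nu is a Lagrange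
   multiplier: at p(nu_dagger) the tangent bound on Phi is constant on the plane sum p_i = Mo, so
   p(nu_dagger) is a maximizer. The smoothed update increases Phi by concavity. *)

theory Submission
  imports Defs
begin

definition score :: "real \<Rightarrow> real \<Rightarrow> real" where
  "score m p = m / p - (1 - m) / (1 - p)"

text \<open>This monotonicity lets entries in (0,1) be compared through their scores, avoiding the
  square root in \<open>p_vec\<close>.\<close>

lemma score_strict_antimono:
  assumes "m \<in> {0<..<1}" and "0 < p" and "p < q" and "q < 1"
  shows "score m q < score m p"
proof -
  have "m / q < m / p" and "(1 - m) / (1 - p) < (1 - m) / (1 - q)"
    using assms by (auto intro!: divide_strict_left_mono)
  then show ?thesis
    by (simp add: score_def)
qed

text \<open>\<open>ln\<close> lies below its tangents. Using this for \<open>ln p\<close> and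
  \<open>ln (1 - p)\<close> with the positive weights \<open>mu $ i\<close> and
  \<open>1 - mu $ i\<close>, the two slopes combine to \<open>score\<close>.\<close>

lemma Phi_le_tangent:
  fixes mu p q :: "real ^ 'm"
  assumes mu: "\<forall>i. mu $ i \<in> {0<..<1}"
    and p: "\<forall>i. p $ i \<in> {0<..<1}" and q: "\<forall>i. q $ i \<in> {0<..<1}"
  shows "Phi mu q \<le> Phi mu p + (\<Sum>i\<in>UNIV. score (mu $ i) (p $ i) * (q $ i - p $ i))"
proof -
  have "mu $ i * ln (q $ i) + (1 - mu $ i) * ln (1 - q $ i)
      \<le> mu $ i * ln (p $ i) + (1 - mu $ i) * ln (1 - p $ i)
        + score (mu $ i) (p $ i) * (q $ i - p $ i)" for i
  proof -
    let ?m = "mu $ i" and ?p = "p $ i" and ?q = "q $ i"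
    have m: "0 < ?m" "?m < 1" and p': "0 < ?p" "?p < 1" and q': "0 < ?q" "?q < 1"
      using mu p q by auto
    have "ln ?q - ln ?p \<le> (?q - ?p) / ?p"
      using p' q' by (intro ln_diff_le) auto
    then have 1: "?m * (ln ?q - ln ?p) \<le> ?m * ((?q - ?p) / ?p)"
      using m by (intro mult_left_mono) auto
    have "ln (1 - ?q) - ln (1 - ?p) \<le> ((1 - ?q) - (1 - ?p)) / (1 - ?p)"
      using p' q' by (intro ln_diff_le) auto
    then have 2: "(1 - ?m) * (ln (1 - ?q) - ln (1 - ?p))
        \<le> (1 - ?m) * (((1 - ?q) - (1 - ?p)) / (1 - ?p))"
      using m by (intro mult_left_mono) auto
    have "?m * ((?q - ?p) / ?p) + (1 - ?m) * (((1 - ?q) - (1 - ?p)) / (1 - ?p))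
        = score ?m ?p * (?q - ?p)"
      using p' by (simp add: score_def divide_simps) (simp add: algebra_simps)
    with 1 2 show ?thesis
      by (simp add: algebra_simps)
  qed
  then show ?thesis
    unfolding Phi_def sum.distrib [symmetric] by (intro sum_mono) auto
qed

text \<open>The tangent bound at the mixed point \<open>r\<close> is applied to both
  \<open>p\<close> and \<open>q\<close>; averaging with weights \<open>1 - w\<close> and
  \<open>w\<close> cancels the linear terms.\<close>

lemma Phi_concave:
  fixes mu p q :: "real ^ 'm"
  assumes mu: "\<forall>i. mu $ i \<in> {0<..<1}"
    and p: "\<forall>i. p $ i \<in> {0<..<1}" and q: "\<forall>i. q $ i \<in> {0<..<1}"
    and w: "0 \<le> w" "w \<le> 1"
  shows "(1 - w) * Phi mu p + w * Phi mu q \<le> Phi mu ((1 - w) *\<^sub>R p + w *\<^sub>R q)"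
proof -
  define r where "r = (1 - w) *\<^sub>R p + w *\<^sub>R q"
  have r: "\<forall>i. r $ i \<in> {0<..<1}"
  proof
    fix i
    have "(1 - w) *\<^sub>R p $ i + w *\<^sub>R q $ i \<in> {0<..<1}"
      using p q w by (intro convexD [OF convex_real_interval(8)]) auto
    then show "r $ i \<in> {0<..<1}"
      by (simp add: r_def)
  qed
  \<comment> \<open>Since \<open>p - r = - w (q - p)\<close> and
    \<open>q - r = (1 - w) (q - p)\<close>, both linear terms are multiples of
    \<open>T\<close>.\<close>
  define T where "T = (\<Sum>i\<in>UNIV. score (mu $ i) (r $ i) * (q $ i - p $ i))"
  have "Phi mu p \<le> Phi mu r - w * T"
  proof -
    have "(\<Sum>i\<in>UNIV. score (mu $ i) (r $ i) * (p $ i - r $ i)) = - w * T"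
      unfolding T_def sum_distrib_left by (intro sum.cong) (auto simp: r_def algebra_simps)
    with Phi_le_tangent [OF mu r p] show ?thesis by simp
  qed
  then have 1: "(1 - w) * Phi mu p \<le> (1 - w) * (Phi mu r - w * T)"
    using w by (intro mult_left_mono) auto
  have "Phi mu q \<le> Phi mu r + (1 - w) * T"
  proof -
    have "(\<Sum>i\<in>UNIV. score (mu $ i) (r $ i) * (q $ i - r $ i)) = (1 - w) * T"
      unfolding T_def sum_distrib_left by (intro sum.cong) (auto simp: r_def algebra_simps)
    with Phi_le_tangent [OF mu r q] show ?thesis by simp
  qed
  then have "w * Phi mu q \<le> w * (Phi mu r + (1 - w) * T)"
    using w by (intro mult_left_mono) auto
  with 1 show ?thesis
    unfolding r_def [symmetric] by (simp add: algebra_simps)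
qed

text \<open>The discriminant exceeds the square of \<open>2 * m - (nu + 1)\<close> by exactly
  \<open>4 * m * (1 - m)\<close>. In particular the root is positive and \<open>(nu + 1)\<close>
  plus the root exceeds \<open>2 * m\<close>.\<close>

lemma sqrt_discriminant_gt:
  fixes m nu :: real
  assumes "m \<in> {0<..<1}"
  shows "\<bar>2 * m - (nu + 1)\<bar> < sqrt ((nu + 1)\<^sup>2 - 4 * nu * m)"
proof (rule real_less_rsqrt)
  have "0 < 4 * (m * (1 - m))"
    using assms by simp
  then show "\<bar>2 * m - (nu + 1)\<bar>\<^sup>2 < (nu + 1)\<^sup>2 - 4 * nu * m"
    by (simp add: power2_eq_square algebra_simps)
qed

text \<open>Rationalizing the numerator removes the singularity at \<open>nu = 0\<close>.\<close>

lemma p_vec_rationalized: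
  fixes mu :: "real ^ 'm"
  assumes "mu $ i \<in> {0<..<1}"
  shows "p_vec mu nu $ i
    = 2 * mu $ i / ((nu + 1) + sqrt ((nu + 1)\<^sup>2 - 4 * nu * mu $ i))"
proof (cases "nu = 0")
  case False
  define s where "s = sqrt ((nu + 1)\<^sup>2 - 4 * nu * mu $ i)"
  have s: "\<bar>2 * mu $ i - (nu + 1)\<bar> < s"
    unfolding s_def by (rule sqrt_discriminant_gt [OF assms])
  have "s\<^sup>2 = (nu + 1)\<^sup>2 - 4 * nu * mu $ i"
    using s unfolding s_def by (intro real_sqrt_pow2) (smt (verit) real_sqrt_lt_0_iff)
  then have "((nu + 1) - s) * ((nu + 1) + s) = 2 * mu $ i * (2 * nu)"
    by (simp add: power2_eq_square algebra_simps)
  moreover have "(nu + 1) + s \<noteq> 0"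
    using s assms by auto
  ultimately have "((nu + 1) - s) / (2 * nu) = 2 * mu $ i / ((nu + 1) + s)"
    using False by (subst frac_eq_eq) auto
  with False show ?thesis
    by (simp add: p_vec_def s_def)
qed (simp add: p_vec_def)

text \<open>The rationalized denominator is larger than the positive numerator
  \<open>2 * mu $ i\<close>.\<close>

lemma p_vec_in_unit_interval:
  fixes mu :: "real ^ 'm"
  assumes "mu $ i \<in> {0<..<1}"
  shows "p_vec mu nu $ i \<in> {0<..<1}"
  using sqrt_discriminant_gt [OF assms, of nu] assms
  unfolding p_vec_rationalized [OF assms] by (auto simp: divide_simps)

text \<open>The formula for \<open>p\<close> solves
  \<open>nu * p^2 - (nu + 1) * p + mu $ i = 0\<close>, that is,
  \<open>mu $ i - p = nu * p * (1 - p)\<close>; dividing by \<open>p * (1 - p)\<close> turns the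
  left side into the score.\<close>

lemma score_p_vec:
  fixes mu :: "real ^ 'm"
  assumes "mu $ i \<in> {0<..<1}"
  shows "score (mu $ i) (p_vec mu nu $ i) = nu"
proof -
  define p where "p = p_vec mu nu $ i"
  have p: "0 < p" "p < 1"
    using p_vec_in_unit_interval [OF assms, of nu] by (auto simp: p_def)
  have "mu $ i - p = nu * (p * (1 - p))"
  proof (cases "nu = 0")
    case False
    define s where "s = sqrt ((nu + 1)\<^sup>2 - 4 * nu * mu $ i)"
    have "0 < s"
      unfolding s_def using sqrt_discriminant_gt [OF assms, of nu] by (rule le_less_trans [OF abs_ge_zero])
    then have s2: "s\<^sup>2 = (nu + 1)\<^sup>2 - 4 * nu * mu $ i"
      unfolding s_def by (intro real_sqrt_pow2) (simp only: real_sqrt_gt_0_iff less_imp_le)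
    have "s = nu + 1 - 2 * nu * p"
      using False by (simp add: p_def p_vec_def s_def)
    with s2 have "4 * nu * (mu $ i - p) = 4 * nu * (nu * (p * (1 - p)))"
      by (simp add: power2_eq_square algebra_simps)
    with False show ?thesis by simp
  qed (simp add: p_def p_vec_def)
  moreover have "score (mu $ i) p = (mu $ i - p) / (p * (1 - p))"
    using p by (simp add: score_def divide_simps) (simp add: algebra_simps)
  ultimately show ?thesis
    using p by (simp add: p_def)
qed

text \<open>The score is strictly decreasing and takes the value \<open>nu\<close> at
  \<open>p_vec mu nu $ i\<close>. The equivalence serves both monotonicity in \<open>nu\<close> and
  the bracketing of the multiplier.\<close>

lemma p_vec_le_iff:
  fixes mu :: "real ^ 'm"
  assumes "mu $ i \<in> {0<..<1}" and "q \<in> {0<..<1}"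
  shows "p_vec mu nu $ i \<le> q \<longleftrightarrow> score (mu $ i) q \<le> nu"
  using score_strict_antimono [OF assms(1), of q "p_vec mu nu $ i"]
    score_strict_antimono [OF assms(1), of "p_vec mu nu $ i" q]
    p_vec_in_unit_interval [OF assms(1), of nu] score_p_vec [OF assms(1), of nu] assms(2)
  by (cases "p_vec mu nu $ i" q rule: linorder_cases) auto

lemma p_vec_strict_antimono:
  fixes mu :: "real ^ 'm"
  assumes "mu $ i \<in> {0<..<1}" and "nu < nu'"
  shows "p_vec mu nu' $ i < p_vec mu nu $ i"
  using p_vec_le_iff [OF assms(1) p_vec_in_unit_interval [OF assms(1)], of nu nu']
    score_p_vec [OF assms(1)] assms(2) by (simp add: not_le [symmetric])

lemma continuous_on_p_vec:
  fixes mu :: "real ^ 'm"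
  assumes "mu $ i \<in> {0<..<1}"
  shows "continuous_on A (\<lambda>nu. p_vec mu nu $ i)"
proof -
  have "(nu + 1) + sqrt ((nu + 1)\<^sup>2 - 4 * nu * mu $ i) \<noteq> 0" for nu
    using sqrt_discriminant_gt [OF assms, of nu] assms by auto
  then show ?thesis
    unfolding p_vec_rationalized [OF assms] by (intro continuous_intros) auto
qed

text \<open>The coordinate sum is continuous and strictly decreasing in \<open>nu\<close>, so the
  intermediate value theorem gives existence and monotonicity gives uniqueness. This makes the
  description in \<open>nu_dagger\<close> denote.\<close>

lemma ex1_sum_p_vec_eq:
  fixes mu :: "real ^ 'm"
  assumes mu: "\<forall>i. mu $ i \<in> {0<..<1}" and "0 < Mo" and "Mo < CARD('m)"
  shows "\<exists>!nu. (\<Sum>i\<in>UNIV. p_vec mu nu $ i) = real Mo"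
proof -
  define S where "S nu = (\<Sum>i\<in>UNIV. p_vec mu nu $ i)" for nu
  have anti: "S b < S a" if "a < b" for a b
    unfolding S_def using mu that by (intro sum_strict_mono p_vec_strict_antimono) auto
  have cont: "continuous_on A S" for A
    unfolding S_def using mu by (intro continuous_on_sum continuous_on_p_vec) auto
  \<comment> \<open>The common entry of the uniform feasible vector;
    \<open>0 < Mo < CARD('m)\<close> places it in (0,1).\<close>
  define q where "q = real Mo / real CARD('m)"
  have q: "q \<in> {0<..<1}" and card_q: "real CARD('m) * q = real Mo"
    using assms(2,3) by (auto simp: q_def)
  define G where "G = range (\<lambda>i. score (mu $ i) q)"
  have G: "finite G" "G \<noteq> {}"
    by (auto simp: G_def)
  \<comment> \<open>All \<open>p_i\<close> lie below the uniform value \<open>q\<close> at \<open>Max G\<close>, and above it left of \<open>Min G\<close>.\<close>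
  have "p_vec mu (Max G) $ i \<le> q" for i
    using p_vec_le_iff [of mu i q "Max G"] mu q G by (auto simp: G_def)
  then have upper: "S (Max G) \<le> real Mo"
    unfolding S_def card_q [symmetric] by (intro sum_bounded_above) auto
  \<comment> \<open>The shift by 1 puts \<open>nu\<close> strictly below every score at
    \<open>q\<close>, so that negating \<open>p_vec_le_iff\<close> applies.\<close>
  have "q \<le> p_vec mu (Min G - 1) $ i" for i
  proof -
    have "Min G \<le> score (mu $ i) q"
      using G by (intro Min_le) (auto simp: G_def)
    then show ?thesis
      using p_vec_le_iff [of mu i q "Min G - 1"] mu q by auto
  qed
  then have lower: "real Mo \<le> S (Min G - 1)"
    unfolding S_def card_q [symmetric] by (intro sum_bounded_below) auto
  have "Min G \<le> Max G"
    using G by (meson Max_ge Min_in)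
  then obtain nu where "S nu = real Mo"
    using IVT2' [of S "Max G" "real Mo" "Min G - 1"] upper lower cont by auto
  moreover have "nu' = nu''" if "S nu' = real Mo" "S nu'' = real Mo" for nu' nu''
    using anti [of nu' nu''] anti [of nu'' nu'] that by (cases nu' nu'' rule: linorder_cases) auto
  ultimately show ?thesis
    unfolding S_def by blast
qed

lemma feasible_p_CE:
  fixes mu :: "real ^ 'm"
  assumes "\<forall>i. mu $ i \<in> {0<..<1}" and "0 < Mo" and "Mo < CARD('m)"
  shows "feasible Mo (p_CE Mo mu)"
  using theI' [OF ex1_sum_p_vec_eq [OF assms]] p_vec_in_unit_interval assms(1)
  unfolding feasible_def p_CE_def nu_dagger_def by blast

lemma Phi_le_Phi_p_CE:
  fixes mu q :: "real ^ 'm"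
  assumes mu: "\<forall>i. mu $ i \<in> {0<..<1}" and "0 < Mo" and "Mo < CARD('m)" and q: "feasible Mo q"
  shows "Phi mu q \<le> Phi mu (p_CE Mo mu)"
proof -
  let ?p = "p_CE Mo mu"
  have p: "feasible Mo ?p"
    using assms by (intro feasible_p_CE)
  have "Phi mu q \<le> Phi mu ?p + (\<Sum>i\<in>UNIV. score (mu $ i) (?p $ i) * (q $ i - ?p $ i))"
    using mu p q by (intro Phi_le_tangent) (auto simp: feasible_def)
  \<comment> \<open>All scores at \<open>p_CE\<close> equal the multiplier, so it factors out and
    only the two coordinate sums remain, both equal to \<open>Mo\<close>.\<close>
  also have "(\<Sum>i\<in>UNIV. score (mu $ i) (?p $ i) * (q $ i - ?p $ i))
      = nu_dagger Mo mu * ((\<Sum>i\<in>UNIV. q $ i) - (\<Sum>i\<in>UNIV. ?p $ i))"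
    using mu unfolding p_CE_def
    by (simp add: score_p_vec sum_distrib_left [symmetric] sum_subtractf)
  also have "\<dots> = 0"
    using p q by (simp add: feasible_def)
  finally show ?thesis by simp
qed

theorem theorem4:
  fixes Mo :: nat
    and E :: "'e set"
    and zeta :: "'e \<Rightarrow> real ^ 'm"
    and mu pt :: "real ^ 'm"
  assumes "0 < Mo" and "Mo < CARD('m)"
    and "finite E" and "E \<noteq> {}"
    and "\<forall>n\<in>E. \<forall>i. zeta n $ i \<in> {0, 1}"
    and "mu = elite_mean E zeta"
    and "\<forall>i. mu $ i \<in> {0<..<1}"
    and "feasible Mo pt"
  shows "(\<not> is_arg_max (Phi mu) (feasible Mo) pt \<longrightarrow> Phi mu (p_CE Mo mu) > Phi mu pt) \<and>
    (\<forall>\<omega>\<in>{0<..1}. Phi mu ((1 - \<omega>) *\<^sub>R pt + \<omega> *\<^sub>R p_CE Mo mu) \<ge> Phi mu pt)"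
proof (intro conjI impI ballI)
  note mu = assms(7) and pt = assms(8)
  note max = Phi_le_Phi_p_CE [OF mu assms(1,2)]
  show "Phi mu pt < Phi mu (p_CE Mo mu)" if not_max: "\<not> is_arg_max (Phi mu) (feasible Mo) pt"
  proof -
    \<comment> \<open>Strictness comes from this witness: \<open>pt\<close> is feasible, so if it is
      not a maximizer some feasible \<open>q\<close> beats it, and \<open>p_CE\<close> is at least
      as good as \<open>q\<close>.\<close>
    obtain q where "feasible Mo q" "Phi mu pt < Phi mu q"
      using not_max pt by (auto simp: is_arg_max_def)
    with max [of q] show ?thesis by simp
  qed
  fix \<omega> :: real
  assume w: "\<omega> \<in> {0<..1}"
  have "\<omega> * Phi mu pt \<le> \<omega> * Phi mu (p_CE Mo mu)"
    using max [OF pt] w by (intro mult_left_mono) auto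
  then have "Phi mu pt \<le> (1 - \<omega>) * Phi mu pt + \<omega> * Phi mu (p_CE Mo mu)"
    by (simp add: algebra_simps)
  also have "\<dots> \<le> Phi mu ((1 - \<omega>) *\<^sub>R pt + \<omega> *\<^sub>R p_CE Mo mu)"
    using mu pt feasible_p_CE [OF mu assms(1,2)] w
    by (intro Phi_concave) (auto simp: feasible_def)
  finally show "Phi mu pt \<le> Phi mu ((1 - \<omega>) *\<^sub>R pt + \<omega> *\<^sub>R p_CE Mo mu)" .
qed

end
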